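(* Let $\mathbf C$ be a category with a functor $|\cdot|:\mathbf C\to\mathbf{Set}$ and binary products, let $F:\mathbf C\to\mathbf C$ be a functor, and let $\lambda:\Psi\to\Psi F$ be an indexed morphism with $\lambda_X(\equiv_X)=\,\equiv_{FX}$ for all $X$. Assume the behavioural conformance exists: for every $F$-coalgebra $(X,\alpha)$ the set $\{R\in\Psi X\mid R\subseteq\alpha^*\lambda_XR\}$ has a greatest element $1^\lambda_X$, and $f^*(1^\lambda_Y)=1^\lambda_X$ for every coalgebra homomorphism $f:(X,\alpha)\to(Y,\beta)$. Let $\mathcal S:\mathbf C\to\mathbf A^{op}$ and $\mathcal T:\mathbf A^{op}\to\mathbf C$ be functors with $\mathcal S\dashv\mathcal T$, let $L:\mathbf A\to\mathbf A$ have an initial algebra $h:L\mathcal A\to\mathcal A$, and let $\delta:F\mathcal T\Rightarrow\mathcal T L$ be a natural transformation (components $\delta_B:F\mathcal T B\to\mathcal T LB$ in $\mathbf C$). If the functor $\mathrm{Eq}\circ\mathcal T:\mathbf A^{op}\to\int\Psi$ has a left adjoint, then the logic $(L,\delta)$ is adequate. Moreover, it is expressive if the function $|\delta_{\mathcal A}|$ is injective.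
   Context: Binary products in $\mathbf C$: $X\otimes Y$, projections $\pi_1^X,\pi_2^X:X\otimes X\to X$, $g\otimes g$ induced. $\Psi X$ = poset of subsets of $|X\otimes X|$; for $g:X\to Y$, $g^*(S)=|g\otimes g|^{-1}(S)$. $\equiv_X=\langle|\pi_1^X|,|\pi_2^X|\rangle^{-1}(\{(x,x)\mid x\in|X|\})$. $\int\Psi$ has objects $(X,R)$, $R\in\Psi X$, morphisms $g:(X,R)\to(Y,S)$ those $g:X\to Y$ with $R\subseteq g^*S$; $\mathrm{Eq}:\mathbf C\to\int\Psi$ is $X\mapsto(X,\equiv_X)$, $g\mapsto g$. An indexed morphism $\lambda:\Psi\to\Psi F$ is a family of monotone maps $\lambda_X:\Psi X\to\Psi FX$ with $\lambda_X(g^*S)=(Fg)^*\lambda_YS$. For a coalgebra $\alpha:X\to FX$ (in $\mathbf C$) the theory map $\mathrm{th}_X:X\to\mathcal T\mathcal A$ is the unique $\mathbf C$-morphism with $\mathcal T h\circ\mathrm{th}_X=\delta_{\mathcal A}\circ F(\mathrm{th}_X)\circ\alpha$ (it is the adjoint transpose of the initial-algebra semantics $\mathcal A\to\mathcal S X$). The logic $(L,\delta)$ is adequate if for every coalgebra $(X,\alpha)$, $\mathrm{th}_X$ is a morphism $(X,1^\lambda_X)\to(\mathcal T\mathcal A,\equiv_{\mathcal T\mathcal A})$ in $\int\Psi$, i.e. $1^\lambda_X\subseteq\mathrm{th}_X^*(\equiv_{\mathcal T\mathcal A})$; it is expressive if moreover this morphism is Cartesian, i.e. $1^\lambda_X=\mathrm{th}_X^*(\equiv_{\mathcal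 T\mathcal A})$. *)

theory Defs
  imports Main "HOL-Library.FuncSet"
begin

section \<open>Categories, functors, adjunctions\<close>

record ('o, 'a) cat =
  Obj :: "'o set"
  Arr :: "'a set"
  Dom :: "'a \<Rightarrow> 'o"
  Cod :: "'a \<Rightarrow> 'o"
  Id :: "'o \<Rightarrow> 'a"
  Comp :: "'a \<Rightarrow> 'a \<Rightarrow> 'a"  (infixl "\<cdot>\<index>" 70)

definition hom :: "('o, 'a) cat \<Rightarrow> 'o \<Rightarrow> 'o \<Rightarrow> 'a set" where
  "hom C X Y = {f \<in> Arr C. Dom C f = X \<and> Cod C f = Y}"

locale category =
  fixes C :: "('o, 'a) cat" (structure)
  assumes Dom_Obj: "f \<in> Arr C \<Longrightarrow> Dom C f \<in> Obj C"
    and Cod_Obj: "f \<in> Arr C \<Longrightarrow> Cod C f \<in> Obj C"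
    and Id_hom: "X \<in> Obj C \<Longrightarrow> Id C X \<in> hom C X X"
    and Comp_hom: "\<lbrakk>f \<in> hom C X Y; g \<in> hom C Y Z\<rbrakk> \<Longrightarrow> g \<cdot> f \<in> hom C X Z"
    and Id_left: "f \<in> hom C X Y \<Longrightarrow> Id C Y \<cdot> f = f"
    and Id_right: "f \<in> hom C X Y \<Longrightarrow> f \<cdot> Id C X = f"
    and Comp_assoc: "\<lbrakk>f \<in> hom C X Y; g \<in> hom C Y Z; k \<in> hom C Z W\<rbrakk>
      \<Longrightarrow> (k \<cdot> g) \<cdot> f = k \<cdot> (g \<cdot> f)"

definition op_cat :: "('o, 'a) cat \<Rightarrow> ('o, 'a) cat" where
  "op_cat C = \<lparr>Obj = Obj C, Arr = Arr C, Dom = Cod C, Cod = Dom C, Id = Id C,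
     Comp = (\<lambda>g f. f \<cdot>\<^bsub>C\<^esub> g)\<rparr>"

text \<open>A functor is just its two maps, so the same \<open>F\<close> serves as a functor from \<open>C\<close> to \<open>D\<close> and
  from \<open>op_cat C\<close> to \<open>op_cat D\<close>.\<close>

record ('o, 'a, 'p, 'b) func =
  omap :: "'o \<Rightarrow> 'p"
  amap :: "'a \<Rightarrow> 'b"

locale is_functor = dom: category C + cod: category D
  for C :: "('o, 'a) cat" and D :: "('p, 'b) cat" and F :: "('o, 'a, 'p, 'b) func" +
  assumes omap_Obj: "X \<in> Obj C \<Longrightarrow> omap F X \<in> Obj D"
    and amap_hom: "f \<in> hom C X Y \<Longrightarrow> amap F f \<in> hom D (omap F X) (omap F Y)"
    and amap_Id: "X \<in> Obj C \<Longrightarrow> amap F (Id C X) = Id D (omap F X)"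
    and amap_Comp: "\<lbrakk>f \<in> hom C X Y; g \<in> hom C Y Z\<rbrakk>
      \<Longrightarrow> amap F (g \<cdot>\<^bsub>C\<^esub> f) = amap F g \<cdot>\<^bsub>D\<^esub> amap F f"

definition comp_func ::
    "('p, 'b, 'q, 'c) func \<Rightarrow> ('o, 'a, 'p, 'b) func \<Rightarrow> ('o, 'a, 'q, 'c) func" (infixr "\<circ>\<^sub>F" 55)
  where "G \<circ>\<^sub>F F = \<lparr>omap = omap G \<circ> omap F, amap = amap G \<circ> amap F\<rparr>"

definition nat_trans :: "('o, 'a) cat \<Rightarrow> ('p, 'b) cat \<Rightarrow>
    ('o, 'a, 'p, 'b) func \<Rightarrow> ('o, 'a, 'p, 'b) func \<Rightarrow> ('o \<Rightarrow> 'b) \<Rightarrow> bool" where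
  "nat_trans C D F G \<tau> \<longleftrightarrow>
     (\<forall>X \<in> Obj C. \<tau> X \<in> hom D (omap F X) (omap G X)) \<and>
     (\<forall>X Y. \<forall>f \<in> hom C X Y. \<tau> Y \<cdot>\<^bsub>D\<^esub> amap F f = amap G f \<cdot>\<^bsub>D\<^esub> \<tau> X)"

definition adjoint :: "('o, 'a) cat \<Rightarrow> ('p, 'b) cat \<Rightarrow>
    ('o, 'a, 'p, 'b) func \<Rightarrow> ('p, 'b, 'o, 'a) func \<Rightarrow> bool" where
  "adjoint C D S T \<longleftrightarrow> is_functor C D S \<and> is_functor D C T \<and>
     (\<exists>\<phi>. (\<forall>X \<in> Obj C. \<forall>B \<in> Obj D.
              bij_betw (\<phi> X B) (hom D (omap S X) B) (hom C X (omap T B))) \<and>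
          (\<forall>X X' B B'. \<forall>f \<in> hom C X' X. \<forall>k \<in> hom D B B'. \<forall>u \<in> hom D (omap S X) B.
              \<phi> X' B' (k \<cdot>\<^bsub>D\<^esub> u \<cdot>\<^bsub>D\<^esub> amap S f) =
              amap T k \<cdot>\<^bsub>C\<^esub> \<phi> X B u \<cdot>\<^bsub>C\<^esub> f))"

definition has_left_adjoint ::
    "('o, 'a) cat \<Rightarrow> ('p, 'b) cat \<Rightarrow> ('p, 'b, 'o, 'a) func \<Rightarrow> bool" where
  "has_left_adjoint C D T \<longleftrightarrow> (\<exists>S. adjoint C D S T)"

text \<open>The type variable \<open>'u\<close> plays the role of the universe of sets; functions are extensional.\<close>

definition set_cat :: "('u set, 'u set \<times> ('u \<Rightarrow> 'u) \<times> 'u set) cat" where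
  "set_cat = \<lparr>Obj = UNIV, Arr = {(A, f, B). f \<in> A \<rightarrow>\<^sub>E B}, Dom = fst, Cod = snd \<circ> snd,
     Id = (\<lambda>A. (A, \<lambda>x\<in>A. x, A)),
     Comp = (\<lambda>(B', g, D) (A, f, B). (A, compose A g f, D))\<rparr>"

type_synonym ('o, 'a, 'u) set_func =
  "('o, 'a, 'u set, 'u set \<times> ('u \<Rightarrow> 'u) \<times> 'u set) func"

definition ufun :: "('o, 'a, 'u) set_func \<Rightarrow> 'a \<Rightarrow> 'u \<Rightarrow> 'u" where
  "ufun U g = fst (snd (amap U g))"

section \<open>Binary products\<close>

record ('o, 'a) prods =
  tens :: "'o \<Rightarrow> 'o \<Rightarrow> 'o"
  pr1 :: "'o \<Rightarrow> 'o \<Rightarrow> 'a"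
  pr2 :: "'o \<Rightarrow> 'o \<Rightarrow> 'a"

definition binary_products :: "('o, 'a) cat \<Rightarrow> ('o, 'a) prods \<Rightarrow> bool" where
  "binary_products C P \<longleftrightarrow> (\<forall>X \<in> Obj C. \<forall>Y \<in> Obj C.
     tens P X Y \<in> Obj C \<and>
     pr1 P X Y \<in> hom C (tens P X Y) X \<and> pr2 P X Y \<in> hom C (tens P X Y) Y \<and>
     (\<forall>Z \<in> Obj C. \<forall>f \<in> hom C Z X. \<forall>g \<in> hom C Z Y.
        \<exists>!k. k \<in> hom C Z (tens P X Y) \<and> pr1 P X Y \<cdot>\<^bsub>C\<^esub> k = f \<and> pr2 P X Y \<cdot>\<^bsub>C\<^esub> k = g))"

definition tens_arr :: "('o, 'a) cat \<Rightarrow> ('o, 'a) prods \<Rightarrow> 'a \<Rightarrow> 'a \<Rightarrow> 'a" where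
  "tens_arr C P f g = (THE k.
     k \<in> hom C (tens P (Dom C f) (Dom C g)) (tens P (Cod C f) (Cod C g)) \<and>
     pr1 P (Cod C f) (Cod C g) \<cdot>\<^bsub>C\<^esub> k = f \<cdot>\<^bsub>C\<^esub> pr1 P (Dom C f) (Dom C g) \<and>
     pr2 P (Cod C f) (Cod C g) \<cdot>\<^bsub>C\<^esub> k = g \<cdot>\<^bsub>C\<^esub> pr2 P (Dom C f) (Dom C g))"

section \<open>The indexed poset of relations and its Grothendieck construction\<close>

definition Psi :: "('o, 'a, 'u) set_func \<Rightarrow> ('o, 'a) prods \<Rightarrow> 'o \<Rightarrow> 'u set set" where
  "Psi U P X = Pow (omap U (tens P X X))"

definition reindex :: "('o, 'a) cat \<Rightarrow> ('o, 'a, 'u) set_func \<Rightarrow> ('o, 'a) prods \<Rightarrow>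
    'a \<Rightarrow> 'u set \<Rightarrow> 'u set" where
  "reindex C U P g S =
     {z \<in> omap U (tens P (Dom C g) (Dom C g)). ufun U (tens_arr C P g g) z \<in> S}"

definition eq_rel :: "('o, 'a, 'u) set_func \<Rightarrow> ('o, 'a) prods \<Rightarrow> 'o \<Rightarrow> 'u set" where
  "eq_rel U P X = {z \<in> omap U (tens P X X).
     (ufun U (pr1 P X X) z, ufun U (pr2 P X X) z) \<in> {(x, x) | x. x \<in> omap U X}}"

definition int_Psi :: "('o, 'a) cat \<Rightarrow> ('o, 'a, 'u) set_func \<Rightarrow> ('o, 'a) prods \<Rightarrow>
    ('o \<times> 'u set, ('o \<times> 'u set) \<times> 'a \<times> ('o \<times> 'u set)) cat" where
  "int_Psi C U P = \<lparr>
     Obj = {(X, R). X \<in> Obj C \<and> R \<in> Psi U P X},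
     Arr = {((X, R), g, (Y, S)). X \<in> Obj C \<and> R \<in> Psi U P X \<and> Y \<in> Obj C \<and> S \<in> Psi U P Y \<and>
              g \<in> hom C X Y \<and> R \<subseteq> reindex C U P g S},
     Dom = fst, Cod = snd \<circ> snd,
     Id = (\<lambda>(X, R). ((X, R), Id C X, (X, R))),
     Comp = (\<lambda>(b', g, c) (a, f, b). (a, g \<cdot>\<^bsub>C\<^esub> f, c))\<rparr>"

definition Eq_func :: "('o, 'a) cat \<Rightarrow> ('o, 'a, 'u) set_func \<Rightarrow> ('o, 'a) prods \<Rightarrow>
    ('o, 'a, 'o \<times> 'u set, ('o \<times> 'u set) \<times> 'a \<times> ('o \<times> 'u set)) func" where
  "Eq_func C U P = \<lparr>
     omap = (\<lambda>X. (X, eq_rel U P X)),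
     amap = (\<lambda>g. ((Dom C g, eq_rel U P (Dom C g)), g, (Cod C g, eq_rel U P (Cod C g))))\<rparr>"

definition indexed_morphism :: "('o, 'a) cat \<Rightarrow> ('o, 'a, 'u) set_func \<Rightarrow> ('o, 'a) prods \<Rightarrow>
    ('o, 'a, 'o, 'a) func \<Rightarrow> ('o \<Rightarrow> 'u set \<Rightarrow> 'u set) \<Rightarrow> bool" where
  "indexed_morphism C U P F lam \<longleftrightarrow>
     (\<forall>X \<in> Obj C. lam X \<in> Psi U P X \<rightarrow> Psi U P (omap F X) \<and> mono_on (Psi U P X) (lam X)) \<and>
     (\<forall>X Y. \<forall>g \<in> hom C X Y. \<forall>S \<in> Psi U P Y.
        lam X (reindex C U P g S) = reindex C U P (amap F g) (lam Y S))"

section \<open>Coalgebras, behavioural conformance and coalgebraic logics\<close>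

definition coalgebra :: "('o, 'a) cat \<Rightarrow> ('o, 'a, 'o, 'a) func \<Rightarrow> 'o \<Rightarrow> 'a \<Rightarrow> bool" where
  "coalgebra C F X \<alpha> \<longleftrightarrow> X \<in> Obj C \<and> \<alpha> \<in> hom C X (omap F X)"

definition coalgebra_hom :: "('o, 'a) cat \<Rightarrow> ('o, 'a, 'o, 'a) func \<Rightarrow>
    'o \<Rightarrow> 'a \<Rightarrow> 'o \<Rightarrow> 'a \<Rightarrow> 'a \<Rightarrow> bool" where
  "coalgebra_hom C F X \<alpha> Y \<beta> f \<longleftrightarrow>
     f \<in> hom C X Y \<and> \<beta> \<cdot>\<^bsub>C\<^esub> f = amap F f \<cdot>\<^bsub>C\<^esub> \<alpha>"

definition is_bisim :: "('o, 'a) cat \<Rightarrow> ('o, 'a, 'u) set_func \<Rightarrow> ('o, 'a) prods \<Rightarrow>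
    ('o \<Rightarrow> 'u set \<Rightarrow> 'u set) \<Rightarrow> 'o \<Rightarrow> 'a \<Rightarrow> 'u set \<Rightarrow> bool" where
  "is_bisim C U P lam X \<alpha> R \<longleftrightarrow> R \<in> Psi U P X \<and> R \<subseteq> reindex C U P \<alpha> (lam X R)"

definition conformance :: "('o, 'a) cat \<Rightarrow> ('o, 'a, 'u) set_func \<Rightarrow> ('o, 'a) prods \<Rightarrow>
    ('o \<Rightarrow> 'u set \<Rightarrow> 'u set) \<Rightarrow> 'o \<Rightarrow> 'a \<Rightarrow> 'u set" where
  "conformance C U P lam X \<alpha> = (GREATEST R. is_bisim C U P lam X \<alpha> R)"

definition conformance_exists :: "('o, 'a) cat \<Rightarrow> ('o, 'a, 'u) set_func \<Rightarrow> ('o, 'a) prods \<Rightarrow>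
    ('o, 'a, 'o, 'a) func \<Rightarrow> ('o \<Rightarrow> 'u set \<Rightarrow> 'u set) \<Rightarrow> bool" where
  "conformance_exists C U P F lam \<longleftrightarrow>
     (\<forall>X \<alpha>. coalgebra C F X \<alpha> \<longrightarrow>
        (\<exists>R. is_bisim C U P lam X \<alpha> R \<and> (\<forall>R'. is_bisim C U P lam X \<alpha> R' \<longrightarrow> R' \<subseteq> R))) \<and>
     (\<forall>X \<alpha> Y \<beta> f. coalgebra C F X \<alpha> \<longrightarrow> coalgebra C F Y \<beta> \<longrightarrow>
        coalgebra_hom C F X \<alpha> Y \<beta> f \<longrightarrow>
        reindex C U P f (conformance C U P lam Y \<beta>) = conformance C U P lam X \<alpha>)"

definition initial_algebra :: "('p, 'b) cat \<Rightarrow> ('p, 'b, 'p, 'b) func \<Rightarrow> 'p \<Rightarrow> 'b \<Rightarrow> bool" where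
  "initial_algebra A L I h \<longleftrightarrow> I \<in> Obj A \<and> h \<in> hom A (omap L I) I \<and>
     (\<forall>B \<in> Obj A. \<forall>k \<in> hom A (omap L B) B.
        \<exists>!f. f \<in> hom A I B \<and> f \<cdot>\<^bsub>A\<^esub> h = k \<cdot>\<^bsub>A\<^esub> amap L f)"

text \<open>In \<open>theory_map\<close> and below, \<open>T\<close> is a functor out of \<open>op_cat A\<close>, \<open>(I, h)\<close> is the initial
  \<open>L\<close>-algebra and \<open>d\<close> is the natural transformation \<open>\<delta>\<close>; hence \<open>amap T h\<close> is an arrow from
  \<open>omap T I\<close> to \<open>omap T (omap L I)\<close> in \<open>C\<close>.\<close>

definition theory_map :: "('o, 'a) cat \<Rightarrow> ('o, 'a, 'o, 'a) func \<Rightarrow> ('p, 'b, 'o, 'a) func \<Rightarrow>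
    'p \<Rightarrow> 'b \<Rightarrow> ('p \<Rightarrow> 'a) \<Rightarrow> 'o \<Rightarrow> 'a \<Rightarrow> 'a" where
  "theory_map C F T I h d X \<alpha> = (THE t. t \<in> hom C X (omap T I) \<and>
     amap T h \<cdot>\<^bsub>C\<^esub> t = d I \<cdot>\<^bsub>C\<^esub> amap F t \<cdot>\<^bsub>C\<^esub> \<alpha>)"

definition adequate :: "('o, 'a) cat \<Rightarrow> ('o, 'a, 'u) set_func \<Rightarrow> ('o, 'a) prods \<Rightarrow>
    ('o, 'a, 'o, 'a) func \<Rightarrow> ('o \<Rightarrow> 'u set \<Rightarrow> 'u set) \<Rightarrow> ('p, 'b, 'o, 'a) func \<Rightarrow>
    'p \<Rightarrow> 'b \<Rightarrow> ('p \<Rightarrow> 'a) \<Rightarrow> bool" where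
  "adequate C U P F lam T I h d \<longleftrightarrow> (\<forall>X \<alpha>. coalgebra C F X \<alpha> \<longrightarrow>
     ((X, conformance C U P lam X \<alpha>), theory_map C F T I h d X \<alpha>,
      (omap T I, eq_rel U P (omap T I)))
     \<in> hom (int_Psi C U P) (X, conformance C U P lam X \<alpha>) (omap T I, eq_rel U P (omap T I)))"

definition expressive :: "('o, 'a) cat \<Rightarrow> ('o, 'a, 'u) set_func \<Rightarrow> ('o, 'a) prods \<Rightarrow>
    ('o, 'a, 'o, 'a) func \<Rightarrow> ('o \<Rightarrow> 'u set \<Rightarrow> 'u set) \<Rightarrow> ('p, 'b, 'o, 'a) func \<Rightarrow>
    'p \<Rightarrow> 'b \<Rightarrow> ('p \<Rightarrow> 'a) \<Rightarrow> bool" where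
  "expressive C U P F lam T I h d \<longleftrightarrow> adequate C U P F lam T I h d \<and>
     (\<forall>X \<alpha>. coalgebra C F X \<alpha> \<longrightarrow>
        conformance C U P lam X \<alpha> =
        reindex C U P (theory_map C F T I h d X \<alpha>) (eq_rel U P (omap T I)))"

end

theory Submission
  imports Defs
begin

text \<open>
  Let \<open>\<eta>\<close> be the unit of the left adjoint of \<open>Eq \<circ> T\<close> at \<open>(X, R)\<close>, where \<open>R\<close> is any bisimulation on
  a coalgebra \<open>(X, \<alpha>)\<close>, and let \<open>Q\<close> be the object of \<open>A\<close> it maps into. Since \<open>lam\<close> preserves
  equality, the bisimulation property says that \<open>\<delta>\<^sub>Q \<circ> F \<eta> \<circ> \<alpha>\<close> is again an arrow out of \<open>(X, R)\<close>
  in the Grothendieck construction, so it factors as \<open>T k \<circ> \<eta>\<close> for an \<open>L\<close>-algebra \<open>k\<close> on \<open>Q\<close>. If \<open>f\<close> is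
  the algebra map from the initial algebra to \<open>(Q, k)\<close>, then \<open>T f \<circ> \<eta>\<close> satisfies the equation defining
  the theory map; by \<open>S \<stileturn> T\<close> that equation has only one solution. Hence the theory map factors
  through \<open>\<eta>\<close> and identifies everything related by \<open>R\<close>. If \<open>|\<delta>\<^sub>I|\<close> is injective, then
  equality on \<open>F (T I)\<close> is the preimage of equality on \<open>T (L I)\<close>, and the defining equation shows that
  the kernel of the theory map is a bisimulation.
\<close>

section \<open>Opposite categories and universal arrows\<close>

lemma hom_op_cat [simp]: "hom (op_cat A) X Y = hom A Y X"
  by (auto simp: hom_def op_cat_def)

lemma Obj_op_cat [simp]: "Obj (op_cat A) = Obj A"
  by (simp add: op_cat_def)

lemma Comp_op_cat [simp]: "Comp (op_cat A) g f = Comp A f g"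
  by (simp add: op_cat_def)

lemma omap_comp_func [simp]: "omap (G \<circ>\<^sub>F F) X = omap G (omap F X)"
  by (simp add: comp_func_def)

lemma amap_comp_func [simp]: "amap (G \<circ>\<^sub>F F) f = amap G (amap F f)"
  by (simp add: comp_func_def)

lemma (in category) hom_Obj:
  assumes "f \<in> hom C X Y"
  shows "X \<in> Obj C" "Y \<in> Obj C"
  using assms Dom_Obj Cod_Obj by (auto simp: hom_def)

text \<open>The unit \<eta> is the image of the identity on \<open>omap S X\<close> under the
  hom-set bijection. Naturality at that identity and at the identity on X gives \<phi> k = T k
  \<eta> for every k, so bijectivity of \<phi> becomes the universal property.\<close>

lemma adjoint_universal_arrow:
  assumes adj: "adjoint C D S T" and X: "X \<in> Obj C"
  shows "\<exists>\<eta> \<in> hom C X (omap T (omap S X)). \<forall>B \<in> Obj D. \<forall>f \<in> hom C X (omap T B).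
    \<exists>!k. k \<in> hom D (omap S X) B \<and> amap T k \<cdot>\<^bsub>C\<^esub> \<eta> = f"
proof -
  interpret S: is_functor C D S using adj by (simp add: adjoint_def)
  interpret T: is_functor D C T using adj by (simp add: adjoint_def)
  from adj obtain \<phi> where bij: "\<And>X B. \<lbrakk>X \<in> Obj C; B \<in> Obj D\<rbrakk> \<Longrightarrow>
        bij_betw (\<phi> X B) (hom D (omap S X) B) (hom C X (omap T B))"
    and nat: "\<And>X X' B B' f k u. \<lbrakk>f \<in> hom C X' X; k \<in> hom D B B'; u \<in> hom D (omap S X) B\<rbrakk> \<Longrightarrow>
        \<phi> X' B' (k \<cdot>\<^bsub>D\<^esub> u \<cdot>\<^bsub>D\<^esub> amap S f) = amap T k \<cdot>\<^bsub>C\<^esub> \<phi> X B u \<cdot>\<^bsub>C\<^esub> f"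
    unfolding adjoint_def by blast
  have SX: "omap S X \<in> Obj D" using X by (rule S.omap_Obj)
  define \<eta> where "\<eta> = \<phi> X (omap S X) (Id D (omap S X))"
  have \<eta>: "\<eta> \<in> hom C X (omap T (omap S X))"
    unfolding \<eta>_def using bij_betw_apply[OF bij[OF X SX] S.cod.Id_hom[OF SX]] .
  have \<phi>: "\<phi> X B k = amap T k \<cdot>\<^bsub>C\<^esub> \<eta>" if k: "k \<in> hom D (omap S X) B" for B k
  proof -
    have "amap T k \<cdot>\<^bsub>C\<^esub> \<eta> \<in> hom C X (omap T B)"
      using \<eta> T.amap_hom[OF k] by (rule S.dom.Comp_hom)
    moreover have "k \<cdot>\<^bsub>D\<^esub> Id D (omap S X) \<cdot>\<^bsub>D\<^esub> amap S (Id C X) = k"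
      using S.cod.Id_right[OF k] by (simp add: S.amap_Id[OF X])
    ultimately show ?thesis
      using nat[OF S.dom.Id_hom[OF X] k S.cod.Id_hom[OF SX]]
      by (simp add: \<eta>_def S.dom.Id_right)
  qed
  show ?thesis
  proof (rule bexI[OF _ \<eta>], intro ballI)
    fix B f assume B: "B \<in> Obj D" and f: "f \<in> hom C X (omap T B)"
    from f have "f \<in> \<phi> X B ` hom D (omap S X) B"
      unfolding bij_betw_imp_surj_on[OF bij[OF X B]] .
    then obtain k where k: "k \<in> hom D (omap S X) B" "\<phi> X B k = f" by blast
    show "\<exists>!k. k \<in> hom D (omap S X) B \<and> amap T k \<cdot>\<^bsub>C\<^esub> \<eta> = f"
    proof (rule ex1I[of _ k])
      show "k \<in> hom D (omap S X) B \<and> amap T k \<cdot>\<^bsub>C\<^esub> \<eta> = f"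
        using k \<phi>[OF k(1)] by simp
      show "k' = k" if "k' \<in> hom D (omap S X) B \<and> amap T k' \<cdot>\<^bsub>C\<^esub> \<eta> = f" for k'
        using that k \<phi> by (intro inj_onD[OF bij_betw_imp_inj_on[OF bij[OF X B]]]) auto
    qed
  qed
qed

section \<open>Relations on concrete categories with products\<close>

locale concrete_category = is_functor C set_cat U
  for C :: "('o, 'a) cat" and U :: "('o, 'a, 'u) set_func" +
  fixes P :: "('o, 'a) prods"
  assumes prods: "binary_products C P"
begin

section \<open>Underlying functions and the action of squares on arrows\<close>

lemma ufun_in:
  assumes "f \<in> hom C X Y" and "x \<in> omap U X"
  shows "ufun U f x \<in> omap U Y"
  using amap_hom[OF assms(1)] assms(2) by (auto simp: hom_def set_cat_def ufun_def)

lemma ufun_Comp: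
  assumes "f \<in> hom C X Y" and "g \<in> hom C Y Z" and "x \<in> omap U X"
  shows "ufun U (g \<cdot>\<^bsub>C\<^esub> f) x = ufun U g (ufun U f x)"
  using amap_hom[OF assms(1)] amap_Comp[OF assms(1,2)] assms(3)
  by (auto simp: hom_def set_cat_def ufun_def compose_def split: prod.splits)

lemma pr_hom:
  assumes "X \<in> Obj C"
  shows "pr1 P X X \<in> hom C (tens P X X) X" "pr2 P X X \<in> hom C (tens P X X) X"
  using prods assms unfolding binary_products_def by blast+

text \<open>The universal property of the product at g composed with each projection; it makes the
  definite description in \<open>tens_arr\<close> meaningful.\<close>

lemma tens_arr_ex1:
  assumes g: "g \<in> hom C X Y"
  shows "\<exists>!k. k \<in> hom C (tens P X X) (tens P Y Y) \<and>
    pr1 P Y Y \<cdot>\<^bsub>C\<^esub> k = g \<cdot>\<^bsub>C\<^esub> pr1 P X X \<and> pr2 P Y Y \<cdot>\<^bsub>C\<^esub> k = g \<cdot>\<^bsub>C\<^esub> pr2 P X X"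
proof -
  have XY: "X \<in> Obj C" "Y \<in> Obj C" using g by (rule dom.hom_Obj)+
  show ?thesis
    using prods XY dom.Comp_hom[OF pr_hom(1)[OF XY(1)] g] dom.Comp_hom[OF pr_hom(2)[OF XY(1)] g]
    unfolding binary_products_def by blast
qed

lemma tens_arr_prop:
  assumes g: "g \<in> hom C X Y"
  shows "tens_arr C P g g \<in> hom C (tens P X X) (tens P Y Y) \<and>
    pr1 P Y Y \<cdot>\<^bsub>C\<^esub> tens_arr C P g g = g \<cdot>\<^bsub>C\<^esub> pr1 P X X \<and>
    pr2 P Y Y \<cdot>\<^bsub>C\<^esub> tens_arr C P g g = g \<cdot>\<^bsub>C\<^esub> pr2 P X X"
proof -
  have "Dom C g = X" "Cod C g = Y" using g by (auto simp: hom_def)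
  with theI'[OF tens_arr_ex1[OF g]] show ?thesis by (simp add: tens_arr_def)
qed

lemma tens_arr_unique:
  assumes g: "g \<in> hom C X Y" and k: "k \<in> hom C (tens P X X) (tens P Y Y)"
    and "pr1 P Y Y \<cdot>\<^bsub>C\<^esub> k = g \<cdot>\<^bsub>C\<^esub> pr1 P X X" and "pr2 P Y Y \<cdot>\<^bsub>C\<^esub> k = g \<cdot>\<^bsub>C\<^esub> pr2 P X X"
  shows "tens_arr C P g g = k"
  using tens_arr_ex1[OF g] tens_arr_prop[OF g] assms by blast

lemma tens_arr_Comp:
  assumes f: "f \<in> hom C X Y" and g: "g \<in> hom C Y Z"
  shows "tens_arr C P (g \<cdot>\<^bsub>C\<^esub> f) (g \<cdot>\<^bsub>C\<^esub> f) = tens_arr C P g g \<cdot>\<^bsub>C\<^esub> tens_arr C P f f"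
proof -
  note tf = tens_arr_prop[OF f] and tg = tens_arr_prop[OF g]
  note tf1 = conjunct1[OF tf] and tg1 = conjunct1[OF tg]
  note pX = pr_hom[OF dom.hom_Obj(1)[OF f]] and pY = pr_hom[OF dom.hom_Obj(1)[OF g]]
    and pZ = pr_hom[OF dom.hom_Obj(2)[OF g]]
  show ?thesis
  proof (rule tens_arr_unique)
    show "g \<cdot>\<^bsub>C\<^esub> f \<in> hom C X Z" using f g by (rule dom.Comp_hom)
    show "tens_arr C P g g \<cdot>\<^bsub>C\<^esub> tens_arr C P f f \<in> hom C (tens P X X) (tens P Z Z)"
      using tf1 tg1 by (rule dom.Comp_hom)
    show "pr1 P Z Z \<cdot>\<^bsub>C\<^esub> (tens_arr C P g g \<cdot>\<^bsub>C\<^esub> tens_arr C P f f) = (g \<cdot>\<^bsub>C\<^esub> f) \<cdot>\<^bsub>C\<^esub> pr1 P X X"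
      using tf tg dom.Comp_assoc[OF tf1 tg1 pZ(1)] dom.Comp_assoc[OF tf1 pY(1) g]
        dom.Comp_assoc[OF pX(1) f g] by metis
    show "pr2 P Z Z \<cdot>\<^bsub>C\<^esub> (tens_arr C P g g \<cdot>\<^bsub>C\<^esub> tens_arr C P f f) = (g \<cdot>\<^bsub>C\<^esub> f) \<cdot>\<^bsub>C\<^esub> pr2 P X X"
      using tf tg dom.Comp_assoc[OF tf1 tg1 pZ(2)] dom.Comp_assoc[OF tf1 pY(2) g]
        dom.Comp_assoc[OF pX(2) f g] by metis
  qed
qed

section \<open>Reindexing, equality and kernels\<close>

lemma reindex_Psi: "g \<in> hom C X Y \<Longrightarrow> reindex C U P g R \<in> Psi U P X"
  by (auto simp: reindex_def Psi_def hom_def)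

lemma reindex_mono: "R \<subseteq> R' \<Longrightarrow> reindex C U P g R \<subseteq> reindex C U P g R'"
  by (auto simp: reindex_def)

text \<open>Preimages reverse composition, and squaring of arrows preserves it by
  \<open>tens_arr_Comp\<close>. The range condition hidden in the inner preimage is supplied by
  \<open>ufun_in\<close>.\<close>

lemma reindex_Comp:
  assumes f: "f \<in> hom C X Y" and g: "g \<in> hom C Y Z"
  shows "reindex C U P (g \<cdot>\<^bsub>C\<^esub> f) R = reindex C U P f (reindex C U P g R)"
proof -
  have D: "Dom C f = X" "Dom C g = Y" "Dom C (g \<cdot>\<^bsub>C\<^esub> f) = X"
    using f g dom.Comp_hom[OF f g] by (auto simp: hom_def)
  have tf: "tens_arr C P f f \<in> hom C (tens P X X) (tens P Y Y)"
    and tg: "tens_arr C P g g \<in> hom C (tens P Y Y) (tens P Z Z)"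
    using tens_arr_prop[OF f] tens_arr_prop[OF g] by blast+
  show ?thesis
    using ufun_in[OF tf] ufun_Comp[OF tf tg] by (auto simp: reindex_def D tens_arr_Comp[OF f g])
qed

lemma eq_rel_Psi: "eq_rel U P X \<in> Psi U P X"
  by (auto simp: eq_rel_def Psi_def)

lemma eq_rel_alt:
  assumes "X \<in> Obj C"
  shows "eq_rel U P X =
    {z \<in> omap U (tens P X X). ufun U (pr1 P X X) z = ufun U (pr2 P X X) z}"
  using ufun_in[OF pr_hom(1)[OF assms]] by (auto simp: eq_rel_def)

text \<open>Pulling equality back along g gives the kernel of |g|. It is expressed through the two
  projections because elements of the underlying set of X \<otimes> X need not be pairs.\<close>

lemma reindex_eq_rel:
  assumes g: "g \<in> hom C X Y"
  shows "reindex C U P g (eq_rel U P Y) = {z \<in> omap U (tens P X X).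
    ufun U g (ufun U (pr1 P X X) z) = ufun U g (ufun U (pr2 P X X) z)}"
proof -
  have X: "X \<in> Obj C" and Y: "Y \<in> Obj C" using g by (rule dom.hom_Obj)+
  have D: "Dom C g = X" using g by (simp add: hom_def)
  note t = tens_arr_prop[OF g]
  note t1 = conjunct1[OF t]
  have "ufun U (pr1 P Y Y) (ufun U (tens_arr C P g g) z) = ufun U g (ufun U (pr1 P X X) z)"
    "ufun U (pr2 P Y Y) (ufun U (tens_arr C P g g) z) = ufun U g (ufun U (pr2 P X X) z)"
    if z: "z \<in> omap U (tens P X X)" for z
    using t ufun_Comp[OF t1 pr_hom(1)[OF Y] z] ufun_Comp[OF t1 pr_hom(2)[OF Y] z]
      ufun_Comp[OF pr_hom(1)[OF X] g z] ufun_Comp[OF pr_hom(2)[OF X] g z] by simp_all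
  then show ?thesis using ufun_in[OF t1] by (auto simp: reindex_def D eq_rel_alt[OF Y])
qed

lemma eq_rel_le_reindex: "g \<in> hom C X Y \<Longrightarrow> eq_rel U P X \<subseteq> reindex C U P g (eq_rel U P Y)"
  by (auto simp: reindex_eq_rel eq_rel_alt[OF dom.hom_Obj(1)])

text \<open>The kernel of an injective function is equality. This is where injectivity of the
  component of \<delta> enters the expressiveness argument.\<close>

lemma eq_rel_eq_reindex:
  assumes g: "g \<in> hom C X Y" and inj: "inj_on (ufun U g) (omap U X)"
  shows "reindex C U P g (eq_rel U P Y) = eq_rel U P X"
proof -
  have X: "X \<in> Obj C" using g by (rule dom.hom_Obj)
  show ?thesis
    using ufun_in[OF pr_hom(1)[OF X]] ufun_in[OF pr_hom(2)[OF X]] inj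
    by (auto simp: reindex_eq_rel[OF g] eq_rel_alt[OF X] dest: inj_onD)
qed

text \<open>Kernels grow under postcomposition, since functions preserve equality.\<close>

lemma reindex_Comp_eq_rel_le:
  assumes f: "f \<in> hom C X Y" and g: "g \<in> hom C Y Z"
  shows "reindex C U P f (eq_rel U P Y) \<subseteq> reindex C U P (g \<cdot>\<^bsub>C\<^esub> f) (eq_rel U P Z)"
  unfolding reindex_Comp[OF f g] by (intro reindex_mono eq_rel_le_reindex[OF g])

section \<open>Arrows and universal arrows in the Grothendieck construction\<close>

lemma hom_int_Psi:
  "hom (int_Psi C U P) (X, R) (Y, R') = {((X, R), g, (Y, R')) | g.
     R \<in> Psi U P X \<and> R' \<in> Psi U P Y \<and> g \<in> hom C X Y \<and> R \<subseteq> reindex C U P g R'}"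
  unfolding hom_def[of "int_Psi C U P"] by (auto simp: int_Psi_def dest: dom.hom_Obj)

text \<open>The universal arrow from (X, R), rewritten in \<open>C\<close> alone: an arrow from (X,
  R) to an equality object is an arrow of \<open>C\<close> whose kernel contains R, and \<eta> is
  the middle component of the unit.\<close>

lemma Eq_universal_arrow:
  assumes adj: "has_left_adjoint (int_Psi C U P) D (Eq_func C U P \<circ>\<^sub>F T)"
    and X: "X \<in> Obj C" and R: "R \<in> Psi U P X"
  shows "\<exists>Q \<in> Obj D. \<exists>\<eta> \<in> hom C X (omap T Q).
    R \<subseteq> reindex C U P \<eta> (eq_rel U P (omap T Q)) \<and>
    (\<forall>B \<in> Obj D. \<forall>f \<in> hom C X (omap T B). R \<subseteq> reindex C U P f (eq_rel U P (omap T B)) \<longrightarrow>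
      (\<exists>k \<in> hom D Q B. amap T k \<cdot>\<^bsub>C\<^esub> \<eta> = f))"
proof -
  let ?E = "int_Psi C U P" and ?G = "Eq_func C U P \<circ>\<^sub>F T"
  obtain S where S: "adjoint ?E D S ?G" using adj by (auto simp: has_left_adjoint_def)
  interpret S: is_functor ?E D S using S by (simp add: adjoint_def)
  have XR: "(X, R) \<in> Obj ?E" using X R by (simp add: int_Psi_def)
  define Q where "Q = omap S (X, R)"
  have G: "omap ?G B = (omap T B, eq_rel U P (omap T B))" for B by (simp add: Eq_func_def)
  obtain u where u: "u \<in> hom ?E (X, R) (omap ?G Q)"
    and univ: "\<And>B v. \<lbrakk>B \<in> Obj D; v \<in> hom ?E (X, R) (omap ?G B)\<rbrakk>
      \<Longrightarrow> \<exists>!k. k \<in> hom D Q B \<and> amap ?G k \<cdot>\<^bsub>?E\<^esub> u = v"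
    using adjoint_universal_arrow[OF S XR, folded Q_def] by blast
  from u obtain \<eta> where u_eq: "u = ((X, R), \<eta>, (omap T Q, eq_rel U P (omap T Q)))"
    and \<eta>: "\<eta> \<in> hom C X (omap T Q)" "R \<subseteq> reindex C U P \<eta> (eq_rel U P (omap T Q))"
    unfolding G hom_int_Psi by blast
  have "\<exists>k \<in> hom D Q B. amap T k \<cdot>\<^bsub>C\<^esub> \<eta> = f"
    if "B \<in> Obj D" "f \<in> hom C X (omap T B)" "R \<subseteq> reindex C U P f (eq_rel U P (omap T B))" for B f
  proof -
    have "((X, R), f, omap ?G B) \<in> hom ?E (X, R) (omap ?G B)"
      using that R eq_rel_Psi unfolding G hom_int_Psi by blast
    from univ[OF that(1) this] obtain k where "k \<in> hom D Q B"
      and "amap ?G k \<cdot>\<^bsub>?E\<^esub> u = ((X, R), f, omap ?G B)" by blast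
    then show ?thesis by (auto simp: u_eq Eq_func_def int_Psi_def)
  qed
  moreover have "Q \<in> Obj D" unfolding Q_def using XR by (rule S.omap_Obj)
  ultimately show ?thesis using \<eta> by blast
qed

end

text \<open>The value of \<open>GREATEST\<close> is determined only once a greatest bisimulation is
  known to exist; the first half of \<open>conformance_exists\<close> provides one.\<close>

lemma conformance_greatest:
  assumes "conformance_exists C U P F lam" and "coalgebra C F X \<alpha>"
  shows "is_bisim C U P lam X \<alpha> (conformance C U P lam X \<alpha>)"
    and "is_bisim C U P lam X \<alpha> R \<Longrightarrow> R \<subseteq> conformance C U P lam X \<alpha>"
proof -
  obtain G where G: "is_bisim C U P lam X \<alpha> G" "\<And>R. is_bisim C U P lam X \<alpha> R \<Longrightarrow> R \<subseteq> G"
    using conjunct1[OF assms(1)[unfolded conformance_exists_def]] assms(2) by blast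
  have "conformance C U P lam X \<alpha> = G"
    unfolding conformance_def by (rule Greatest_equality) (fact G)+
  then show "is_bisim C U P lam X \<alpha> (conformance C U P lam X \<alpha>)"
    and "is_bisim C U P lam X \<alpha> R \<Longrightarrow> R \<subseteq> conformance C U P lam X \<alpha>"
    using G by auto
qed

section \<open>The theory map\<close>

locale coalgebraic_logic =
  F: is_functor C C F + T: is_functor "op_cat A" C T + L: is_functor A A L
  for C :: "('o, 'a) cat" and A :: "('p, 'b) cat"
    and F :: "('o, 'a, 'o, 'a) func" and T :: "('p, 'b, 'o, 'a) func"
    and L :: "('p, 'b, 'p, 'b) func" +
  fixes \<delta> :: "'p \<Rightarrow> 'a" and I :: 'p and h :: 'b
  assumes delta: "nat_trans (op_cat A) C (F \<circ>\<^sub>F T) (T \<circ>\<^sub>F L) \<delta>"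
    and initial: "initial_algebra A L I h"
begin

lemma delta_hom: "B \<in> Obj A \<Longrightarrow> \<delta> B \<in> hom C (omap F (omap T B)) (omap T (omap L B))"
  using delta by (simp add: nat_trans_def)

lemma delta_nat:
  "f \<in> hom A B B' \<Longrightarrow> \<delta> B \<cdot>\<^bsub>C\<^esub> amap F (amap T f) = amap T (amap L f) \<cdot>\<^bsub>C\<^esub> \<delta> B'"
  using delta unfolding nat_trans_def hom_op_cat omap_comp_func amap_comp_func by blast

lemma T_hom: "f \<in> hom A B B' \<Longrightarrow> amap T f \<in> hom C (omap T B') (omap T B)"
  using T.amap_hom[of f B' B] by simp

lemma T_Comp: "\<lbrakk>f \<in> hom A B B'; g \<in> hom A B' B''\<rbrakk> \<Longrightarrow> amap T (g \<cdot>\<^bsub>A\<^esub> f) = amap T f \<cdot>\<^bsub>C\<^esub> amap T g"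
  using T.amap_Comp[of g B'' B' f B] by simp

lemma I_Obj: "I \<in> Obj A" and h_hom: "h \<in> hom A (omap L I) I"
  using initial by (auto simp: initial_algebra_def)

text \<open>The condition under the description operator in \<open>theory_map\<close>, named so that
  existence and uniqueness can be treated separately.\<close>

abbreviation is_theory :: "'o \<Rightarrow> 'a \<Rightarrow> 'a \<Rightarrow> bool" where
  "is_theory X \<alpha> t \<equiv>
    t \<in> hom C X (omap T I) \<and> amap T h \<cdot>\<^bsub>C\<^esub> t = \<delta> I \<cdot>\<^bsub>C\<^esub> amap F t \<cdot>\<^bsub>C\<^esub> \<alpha>"

lemma step_hom:
  assumes "B \<in> Obj A" and "t \<in> hom C X (omap T B)" and "\<alpha> \<in> hom C X (omap F X)"
  shows "\<delta> B \<cdot>\<^bsub>C\<^esub> amap F t \<cdot>\<^bsub>C\<^esub> \<alpha> \<in> hom C X (omap T (omap L B))"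
  by (rule F.dom.Comp_hom[OF assms(3) F.dom.Comp_hom[OF F.amap_hom[OF assms(2)] delta_hom[OF assms(1)]]])

text \<open>Naturality of \<delta> moves f past \<delta>, turning the theory equation for T f \<eta>
  into the algebra-map equation for f, under T and composed with \<eta>. As \<eta> is arbitrary
  here, these cannot be cancelled yet; in return the lemma applies to the units of both
  adjunctions.\<close>

lemma is_theory_iff:
  assumes \<alpha>: "\<alpha> \<in> hom C X (omap F X)" and \<eta>: "\<eta> \<in> hom C X (omap T Q)"
    and k: "k \<in> hom A (omap L Q) Q" and f: "f \<in> hom A I Q"
    and k_eq: "amap T k \<cdot>\<^bsub>C\<^esub> \<eta> = \<delta> Q \<cdot>\<^bsub>C\<^esub> amap F \<eta> \<cdot>\<^bsub>C\<^esub> \<alpha>"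
  shows "is_theory X \<alpha> (amap T f \<cdot>\<^bsub>C\<^esub> \<eta>) \<longleftrightarrow>
    amap T (f \<cdot>\<^bsub>A\<^esub> h) \<cdot>\<^bsub>C\<^esub> \<eta> = amap T (k \<cdot>\<^bsub>A\<^esub> amap L f) \<cdot>\<^bsub>C\<^esub> \<eta>"
proof -
  have Q: "Q \<in> Obj A" using f by (rule L.dom.hom_Obj)
  note Lf = L.amap_hom[OF f] and Tf = T_hom[OF f] and F\<eta> = F.amap_hom[OF \<eta>]
  note FTf = F.amap_hom[OF Tf] and TLf = T_hom[OF Lf]
  have "amap T h \<cdot>\<^bsub>C\<^esub> (amap T f \<cdot>\<^bsub>C\<^esub> \<eta>) = amap T (f \<cdot>\<^bsub>A\<^esub> h) \<cdot>\<^bsub>C\<^esub> \<eta>"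
    by (simp add: T_Comp[OF h_hom f] F.dom.Comp_assoc[OF \<eta> Tf T_hom[OF h_hom]])
  moreover have "\<delta> I \<cdot>\<^bsub>C\<^esub> amap F (amap T f \<cdot>\<^bsub>C\<^esub> \<eta>) \<cdot>\<^bsub>C\<^esub> \<alpha> = amap T (k \<cdot>\<^bsub>A\<^esub> amap L f) \<cdot>\<^bsub>C\<^esub> \<eta>"
  proof -
    have "\<delta> I \<cdot>\<^bsub>C\<^esub> amap F (amap T f \<cdot>\<^bsub>C\<^esub> \<eta>) = (\<delta> I \<cdot>\<^bsub>C\<^esub> amap F (amap T f)) \<cdot>\<^bsub>C\<^esub> amap F \<eta>"
      by (simp add: F.amap_Comp[OF \<eta> Tf] F.dom.Comp_assoc[OF F\<eta> FTf delta_hom[OF I_Obj]])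
    also have "\<dots> = amap T (amap L f) \<cdot>\<^bsub>C\<^esub> (\<delta> Q \<cdot>\<^bsub>C\<^esub> amap F \<eta>)"
      by (simp add: delta_nat[OF f] F.dom.Comp_assoc[OF F\<eta> delta_hom[OF Q] TLf])
    finally have "\<delta> I \<cdot>\<^bsub>C\<^esub> amap F (amap T f \<cdot>\<^bsub>C\<^esub> \<eta>) \<cdot>\<^bsub>C\<^esub> \<alpha> =
        amap T (amap L f) \<cdot>\<^bsub>C\<^esub> (amap T k \<cdot>\<^bsub>C\<^esub> \<eta>)"
      by (simp add: k_eq F.dom.Comp_assoc[OF \<alpha> F.dom.Comp_hom[OF F\<eta> delta_hom[OF Q]] TLf])
    then show ?thesis
      by (simp add: T_Comp[OF Lf k] F.dom.Comp_assoc[OF \<eta> T_hom[OF k] TLf])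
  qed
  ultimately show ?thesis using F.dom.Comp_hom[OF \<eta> Tf] by simp
qed

lemma is_theory_exists:
  assumes "\<alpha> \<in> hom C X (omap F X)" and "\<eta> \<in> hom C X (omap T Q)" and k: "k \<in> hom A (omap L Q) Q"
    and "amap T k \<cdot>\<^bsub>C\<^esub> \<eta> = \<delta> Q \<cdot>\<^bsub>C\<^esub> amap F \<eta> \<cdot>\<^bsub>C\<^esub> \<alpha>"
  obtains f where "f \<in> hom A I Q" and "is_theory X \<alpha> (amap T f \<cdot>\<^bsub>C\<^esub> \<eta>)"
proof -
  obtain f where f: "f \<in> hom A I Q" "f \<cdot>\<^bsub>A\<^esub> h = k \<cdot>\<^bsub>A\<^esub> amap L f"
    using initial L.dom.hom_Obj(2)[OF k] k unfolding initial_algebra_def by blast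
  then show thesis using that is_theory_iff[OF assms(1,2,3) f(1) assms(4)] by simp
qed

text \<open>With \<eta> the unit of the adjunction between S and T, every candidate has the form T f
  \<eta>, and T and \<eta> can be cancelled. So f is an algebra map out of the initial algebra, of
  which there is only one.\<close>

lemma is_theory_unique:
  assumes adj: "adjoint C (op_cat A) S T" and \<alpha>: "\<alpha> \<in> hom C X (omap F X)"
    and t: "is_theory X \<alpha> t" and t': "is_theory X \<alpha> t'"
  shows "t = t'"
proof -
  have X: "X \<in> Obj C" using \<alpha> by (rule F.dom.hom_Obj)
  define Q where "Q = omap S X"
  obtain \<eta> where \<eta>: "\<eta> \<in> hom C X (omap T Q)"
    and univ: "\<And>B f. \<lbrakk>B \<in> Obj A; f \<in> hom C X (omap T B)\<rbrakk>
      \<Longrightarrow> \<exists>!k. k \<in> hom A B Q \<and> amap T k \<cdot>\<^bsub>C\<^esub> \<eta> = f"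
    using adjoint_universal_arrow[OF adj X, folded Q_def, unfolded Obj_op_cat hom_op_cat] by blast
  have Q: "Q \<in> Obj A"
    using adj X is_functor.omap_Obj[of C "op_cat A" S X] by (simp add: adjoint_def Q_def)
  \<comment> \<open>The one-step behaviour of \<alpha>, observed through \<eta>, transposes to an
    \<open>L\<close>-algebra structure on \<open>Q\<close>.\<close>
  obtain k where k: "k \<in> hom A (omap L Q) Q"
    and k_eq: "amap T k \<cdot>\<^bsub>C\<^esub> \<eta> = \<delta> Q \<cdot>\<^bsub>C\<^esub> amap F \<eta> \<cdot>\<^bsub>C\<^esub> \<alpha>"
    using univ[OF L.omap_Obj[OF Q] step_hom[OF Q \<eta> \<alpha>]] by blast
  have alg: "f \<cdot>\<^bsub>A\<^esub> h = k \<cdot>\<^bsub>A\<^esub> amap L f"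
    if f: "f \<in> hom A I Q" and th: "is_theory X \<alpha> (amap T f \<cdot>\<^bsub>C\<^esub> \<eta>)" for f
  proof -
    have fh: "f \<cdot>\<^bsub>A\<^esub> h \<in> hom A (omap L I) Q" and kf: "k \<cdot>\<^bsub>A\<^esub> amap L f \<in> hom A (omap L I) Q"
      using L.dom.Comp_hom[OF h_hom f] L.dom.Comp_hom[OF L.amap_hom[OF f] k] .
    have "amap T (f \<cdot>\<^bsub>A\<^esub> h) \<cdot>\<^bsub>C\<^esub> \<eta> = amap T (k \<cdot>\<^bsub>A\<^esub> amap L f) \<cdot>\<^bsub>C\<^esub> \<eta>"
      using is_theory_iff[OF \<alpha> \<eta> k f k_eq] th by blast
    \<comment> \<open>Both sides factor the same arrow through \<eta>, so uniqueness in the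
      universal property identifies them.\<close>
    then show ?thesis
      using univ[OF L.omap_Obj[OF I_Obj] F.dom.Comp_hom[OF \<eta> T_hom[OF kf]]] fh kf by blast
  qed
  obtain f where f: "f \<in> hom A I Q" "amap T f \<cdot>\<^bsub>C\<^esub> \<eta> = t"
    using univ[OF I_Obj conjunct1[OF t]] by blast
  obtain f' where f': "f' \<in> hom A I Q" "amap T f' \<cdot>\<^bsub>C\<^esub> \<eta> = t'"
    using univ[OF I_Obj conjunct1[OF t']] by blast
  have "\<exists>!f. f \<in> hom A I Q \<and> f \<cdot>\<^bsub>A\<^esub> h = k \<cdot>\<^bsub>A\<^esub> amap L f"
    using initial Q k unfolding initial_algebra_def by blast
  moreover have "f \<cdot>\<^bsub>A\<^esub> h = k \<cdot>\<^bsub>A\<^esub> amap L f" "f' \<cdot>\<^bsub>A\<^esub> h = k \<cdot>\<^bsub>A\<^esub> amap L f'"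
    using alg[OF f(1)] alg[OF f'(1)] t t' by (simp_all add: f(2) f'(2))
  ultimately have "f = f'" using f(1) f'(1) by blast
  then show ?thesis using f(2) f'(2) by simp
qed

end

section \<open>Comparing the conformance with the kernel of the theory map\<close>

theorem theorem3:
  fixes C :: "('o, 'a) cat" and A :: "('p, 'b) cat"
    and U :: "('o, 'a, 'u) set_func"
    and P :: "('o, 'a) prods"
    and F :: "('o, 'a, 'o, 'a) func"
    and lam :: "'o \<Rightarrow> 'u set \<Rightarrow> 'u set"
    and S :: "('o, 'a, 'p, 'b) func" and T :: "('p, 'b, 'o, 'a) func"
    and L :: "('p, 'b, 'p, 'b) func"
    and I :: 'p and h :: 'b and \<delta> :: "'p \<Rightarrow> 'a"
  assumes "category C" and "category A"
    and "is_functor C set_cat U"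
    and "binary_products C P"
    and "is_functor C C F"
    and "indexed_morphism C U P F lam"
    and "\<forall>X \<in> Obj C. lam X (eq_rel U P X) = eq_rel U P (omap F X)"
    and "conformance_exists C U P F lam"
    and "is_functor C (op_cat A) S" and "is_functor (op_cat A) C T"
    and "adjoint C (op_cat A) S T"
    and "is_functor A A L"
    and "initial_algebra A L I h"
    and "nat_trans (op_cat A) C (F \<circ>\<^sub>F T) (T \<circ>\<^sub>F L) \<delta>"
    and "has_left_adjoint (int_Psi C U P) (op_cat A) (Eq_func C U P \<circ>\<^sub>F T)"
  shows "adequate C U P F lam T I h \<delta> \<and>
    (inj_on (ufun U (\<delta> I)) (omap U (omap F (omap T I))) \<longrightarrow>
      expressive C U P F lam T I h \<delta>)"
proof -
  interpret concrete_category C U P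
    using assms by (simp add: concrete_category_def concrete_category_axioms_def)
  interpret coalgebraic_logic C A F T L \<delta> I h
    using assms by (simp add: coalgebraic_logic_def coalgebraic_logic_axioms_def)
  note lam = assms(6) and lam_eq = assms(7) and conf = assms(8)
  \<comment> \<open>\<open>lam\<close> sends the kernel of g to the kernel of F g: it commutes with
    reindexing and preserves equality.\<close>
  have lam_reindex_eq: "lam X (reindex C U P g (eq_rel U P Y)) =
      reindex C U P (amap F g) (eq_rel U P (omap F Y))" if "g \<in> hom C X Y" for g X Y
    using that lam lam_eq dom.hom_Obj(2)[OF that] eq_rel_Psi[of Y]
    by (simp add: indexed_morphism_def)
  \<comment> \<open>Besides the inclusion, this yields existence of the theory map: the
    factorisation through \<eta> constructs a solution of its equation.\<close>
  have bisim_le_theory: "is_theory X \<alpha> (theory_map C F T I h \<delta> X \<alpha>) \<and>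
      R \<subseteq> reindex C U P (theory_map C F T I h \<delta> X \<alpha>) (eq_rel U P (omap T I))"
    if X: "X \<in> Obj C" and \<alpha>: "\<alpha> \<in> hom C X (omap F X)" and R: "is_bisim C U P lam X \<alpha> R" for X \<alpha> R
  proof -
    have RP: "R \<in> Psi U P X" and R\<alpha>: "R \<subseteq> reindex C U P \<alpha> (lam X R)"
      using R by (auto simp: is_bisim_def)
    obtain Q \<eta> where Q: "Q \<in> Obj A" and \<eta>: "\<eta> \<in> hom C X (omap T Q)"
      and R\<eta>: "R \<subseteq> reindex C U P \<eta> (eq_rel U P (omap T Q))"
      and univ: "\<And>B f. \<lbrakk>B \<in> Obj A; f \<in> hom C X (omap T B);
          R \<subseteq> reindex C U P f (eq_rel U P (omap T B))\<rbrakk>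
        \<Longrightarrow> \<exists>k \<in> hom A B Q. amap T k \<cdot>\<^bsub>C\<^esub> \<eta> = f"
      using Eq_universal_arrow[OF assms(15) X RP, unfolded Obj_op_cat hom_op_cat] by blast
    let ?s = "\<delta> Q \<cdot>\<^bsub>C\<^esub> amap F \<eta> \<cdot>\<^bsub>C\<^esub> \<alpha>"
    note F\<eta> = F.amap_hom[OF \<eta>]
    \<comment> \<open>Monotonicity carries R into the kernel of F \<eta>, hence into that of
      \<delta> F \<eta>; pulling back along \<alpha> then puts R inside the kernel of
      \<open>?s\<close>, as factoring through \<eta> requires.\<close>
    have "lam X R \<subseteq> lam X (reindex C U P \<eta> (eq_rel U P (omap T Q)))"
      using lam X RP R\<eta> reindex_Psi[OF \<eta>]
      by (intro mono_onD[of "Psi U P X" "lam X"]) (auto simp: indexed_morphism_def)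
    also have "\<dots> \<subseteq> reindex C U P (\<delta> Q \<cdot>\<^bsub>C\<^esub> amap F \<eta>) (eq_rel U P (omap T (omap L Q)))"
      unfolding lam_reindex_eq[OF \<eta>] by (rule reindex_Comp_eq_rel_le[OF F\<eta> delta_hom[OF Q]])
    finally have "R \<subseteq> reindex C U P ?s (eq_rel U P (omap T (omap L Q)))"
      unfolding reindex_Comp[OF \<alpha> dom.Comp_hom[OF F\<eta> delta_hom[OF Q]]]
      by (rule order_trans[OF R\<alpha> reindex_mono])
    then obtain k where "k \<in> hom A (omap L Q) Q" "amap T k \<cdot>\<^bsub>C\<^esub> \<eta> = ?s"
      using univ[OF L.omap_Obj[OF Q] step_hom[OF Q \<eta> \<alpha>]] by blast
    then obtain f where f: "f \<in> hom A I Q" and th: "is_theory X \<alpha> (amap T f \<cdot>\<^bsub>C\<^esub> \<eta>)"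
      using is_theory_exists[OF \<alpha> \<eta>] by blast
    have "theory_map C F T I h \<delta> X \<alpha> = amap T f \<cdot>\<^bsub>C\<^esub> \<eta>"
      unfolding theory_map_def
      using th is_theory_unique[OF assms(11) \<alpha>] by (intro the_equality) auto
    then show ?thesis using th order_trans[OF R\<eta> reindex_Comp_eq_rel_le[OF \<eta> T_hom[OF f]]] by simp
  qed
  have conf_le_theory: "is_theory X \<alpha> (theory_map C F T I h \<delta> X \<alpha>) \<and>
      conformance C U P lam X \<alpha> \<in> Psi U P X \<and> conformance C U P lam X \<alpha> \<subseteq>
        reindex C U P (theory_map C F T I h \<delta> X \<alpha>) (eq_rel U P (omap T I))"
    if co: "coalgebra C F X \<alpha>" for X \<alpha>
    using bisim_le_theory conformance_greatest(1)[OF conf co] co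
    by (simp add: coalgebra_def is_bisim_def)
  have adequate: "adequate C U P F lam T I h \<delta>"
    using conf_le_theory eq_rel_Psi by (simp add: adequate_def hom_int_Psi)
  moreover have "expressive C U P F lam T I h \<delta>"
    if inj: "inj_on (ufun U (\<delta> I)) (omap U (omap F (omap T I)))"
    unfolding expressive_def
  proof (intro conjI allI impI adequate)
    fix X \<alpha> assume co: "coalgebra C F X \<alpha>"
    then have \<alpha>: "\<alpha> \<in> hom C X (omap F X)" by (simp add: coalgebra_def)
    define t where "t = theory_map C F T I h \<delta> X \<alpha>"
    have t: "t \<in> hom C X (omap T I)" and t_eq: "amap T h \<cdot>\<^bsub>C\<^esub> t = \<delta> I \<cdot>\<^bsub>C\<^esub> amap F t \<cdot>\<^bsub>C\<^esub> \<alpha>"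
      using conf_le_theory[OF co] by (simp_all add: t_def)
    \<comment> \<open>The kernel of the theory map, to be shown a bisimulation and therefore
      contained in the conformance.\<close>
    let ?K = "reindex C U P t (eq_rel U P (omap T I))"
    note Ft = F.amap_hom[OF t] and \<delta>I = delta_hom[OF I_Obj]
    have "?K \<subseteq> reindex C U P (\<delta> I \<cdot>\<^bsub>C\<^esub> amap F t \<cdot>\<^bsub>C\<^esub> \<alpha>) (eq_rel U P (omap T (omap L I)))"
      using reindex_Comp_eq_rel_le[OF t T_hom[OF h_hom]] by (simp add: t_eq)
    \<comment> \<open>Injectivity replaces equality pulled back along \<delta> by equality on F (T
      I); its pullback along F t is \<open>lam\<close> applied to the kernel of t.\<close>
    also have "\<dots> = reindex C U P \<alpha> (lam X ?K)"
      by (simp add: reindex_Comp[OF \<alpha> dom.Comp_hom[OF Ft \<delta>I]] reindex_Comp[OF Ft \<delta>I]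
          eq_rel_eq_reindex[OF \<delta>I inj] lam_reindex_eq[OF t])
    finally have "is_bisim C U P lam X \<alpha> ?K"
      using reindex_Psi[OF t] by (simp add: is_bisim_def)
    then have "?K \<subseteq> conformance C U P lam X \<alpha>"
      by (rule conformance_greatest(2)[OF conf co])
    then show "conformance C U P lam X \<alpha> =
        reindex C U P (theory_map C F T I h \<delta> X \<alpha>) (eq_rel U P (omap T I))"
      using conf_le_theory[OF co] unfolding t_def by blast
  qed
  ultimately show ?thesis by blast
qed

end
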